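(* Let $n\ge 1$ and let $X_{1,n},\dots,X_{n,n}$ be independent $\mathbb{Z}_+$-valued random variables with power series distributions $$\mathbb{P}(X_{i,n}=k)=p_{i,n}(k)=\frac{a_k\theta_{i,n}^k}{h(\theta_{i,n})},\qquad k\in\mathbb{Z}_+,\ 1\le i\le n,$$ where $a_k\ge 0$, $\theta_{i,n}>0$, $h(\theta)=\sum_{k=0}^\infty a_k\theta^k$, and $h$ is differentiable. Let $$p_{i,n}^*(k)=\frac{(k+1)a_{k+1}\theta_{i,n}^k}{h'(\theta_{i,n})},\qquad k\in\mathbb{Z}_+,$$ and $S_n=\sum_{i=1}^n X_{i,n}$. Let $\lambda>0$ and let $N_\lambda$ be a Poisson random variable with mean $\lambda$. Then $$d_{TV}(S_n,N_\lambda)\le \frac{|\lambda-\mathbb{E}S_n|}{\max(1,\sqrt{\lambda})}+\frac{1}{\max(1,\lambda)}\sum_{i=1}^{n}\mathbb{E}X_{i,n}\sum_{k=1}^{\infty}k\,|p_{i,n}(k)-p_{i,n}^*(k)|.$$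
   Context: $\mathbb{Z}_+=\{0,1,2,\dots\}$. The coefficients $a_k$ are the same for all $i$; only the parameters $\theta_{i,n}$ vary. It is assumed that $0<h(\theta_{i,n})<\infty$ and that $h$ is differentiable at each $\theta_{i,n}$, with $h'(\theta_{i,n})=\sum_{k\ge1}k a_k\theta_{i,n}^{k-1}$ finite, and $h'(\theta_{i,n})>0$ (equivalently, $a_k>0$ for some $k\ge1$), so that $p^*_{i,n}$ is a probability mass function. The right-hand side of the bound is an element of $[0,\infty]$. For $\mathbb{Z}_+$-valued random variables $Z,Y$, the total variation distance is $d_{TV}(Z,Y)=\sup_{A\subseteq\mathbb{Z}}|\mathbb{P}(Z\in A)-\mathbb{P}(Y\in A)|$. *)

theory Defs
  imports "HOL-Probability.Probability"
begin

definition pow_series :: "(nat \<Rightarrow> real) \<Rightarrow> real \<Rightarrow> real" where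
  "pow_series a x = (\<Sum>k. a k * x ^ k)"

text \<open>
  Outside this set \<open>pow_series a\<close> is a junk value, so derivatives are to be taken relative to it.
  At an interior point that is the ordinary two-sided derivative; at a right end point belonging
  to the set it is the left derivative.
\<close>

definition convergence_domain :: "(nat \<Rightarrow> real) \<Rightarrow> real set" where
  "convergence_domain a = {x. summable (\<lambda>k. a k * x ^ k)}"

definition ps_mass :: "(nat \<Rightarrow> real) \<Rightarrow> real \<Rightarrow> nat \<Rightarrow> real" where
  "ps_mass a \<theta> k = a k * \<theta> ^ k / pow_series a \<theta>"

text \<open>The argument \<open>d\<close> is the value at \<open>\<theta>\<close> of the derivative of the power series.\<close>

definition ps_mass_star :: "(nat \<Rightarrow> real) \<Rightarrow> real \<Rightarrow> real \<Rightarrow> nat \<Rightarrow> real" where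
  "ps_mass_star a d \<theta> k = real (k + 1) * a (k + 1) * \<theta> ^ k / d"

text \<open>
  The two random variables may live on different spaces. The supremum is over a bounded set
  (and so is not a junk value) whenever \<open>M\<close> and \<open>N\<close> are probability spaces.
\<close>

definition tv_dist :: "'a measure \<Rightarrow> ('a \<Rightarrow> nat) \<Rightarrow> 'b measure \<Rightarrow> ('b \<Rightarrow> nat) \<Rightarrow> real" where
  "tv_dist M Z N Y =
     (SUP A :: int set.
        \<bar>measure M {\<omega> \<in> space M. int (Z \<omega>) \<in> A} - measure N {\<omega> \<in> space N. int (Y \<omega>) \<in> A}\<bar>)"

end

theory Submission
  imports Defs
begin

text \<open>
  The Stein--Chen method. For \<open>A \<subseteq> \<nat>\<close> let \<open>f\<close> solve
  \<open>\<lambda> f(k+1) - k f(k) = 1\<^sub>A(k) - P(N\<^sub>\<lambda> \<in> A)\<close>. Then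
  \<open>P(S \<in> A) - P(N\<^sub>\<lambda> \<in> A) = (\<lambda> - E S) E f(S+1) + \<Sum>\<^sub>i (E X\<^sub>i E f(S+1) - E X\<^sub>i f(S))\<close>.
  Since \<open>p\<^sub>i\<^sup>*\<close> is the size-biased law of \<open>X\<^sub>i\<close> shifted down by one, conditioning on
  \<open>W = S - X\<^sub>i\<close> turns the \<open>i\<close>-th summand into
  \<open>E X\<^sub>i \<Sum>\<^sub>k (p\<^sub>i(k) - p\<^sub>i\<^sup>*(k)) E (f(W+k+1) - f(W+1))\<close>, where the subtracted term is
  free because both laws have mass \<open>1\<close>. It remains to use
  \<open>|f| \<le> 1 / max 1 (sqrt \<lambda>)\<close> and \<open>|f(k+2) - f(k+1)| \<le> 1 / max 1 \<lambda>\<close>.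

  Writing \<open>P\<close>, \<open>Q\<close> for the Poisson masses of \<open>{..k}\<close>, \<open>{k<..}\<close> and \<open>\<pi>\<close> for that of \<open>{k}\<close>,
  the first bound amounts to \<open>P Q \<le> \<lambda> \<pi> / max 1 (sqrt \<lambda>)\<close>, which follows from
  \<open>sqrt \<lambda> \<pi> \<le> 1/2\<close>.
\<close>

declare pmf_poisson [simp del]

section \<open>A Stirling-type lower bound for factorials\<close>

lemma has_real_derivative_xlnx:
  fixes x :: real
  assumes "x > 0"
  shows "((\<lambda>x. x * (ln x - 1)) has_real_derivative ln x) (at x)"
  using assms by (auto intro!: derivative_eq_intros)

text \<open>Since \<open>x * (ln x - 1)\<close> is an antiderivative of \<open>ln\<close>, this is
  the midpoint bound for a concave function. The interval is grown symmetrically about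
  \<open>x\<close>; the derivative in the half-length \<open>t\<close> is nonpositive because
  \<open>(x + t) * (x - t) \<le> x * x\<close>.\<close>

lemma xlnx_midpoint_bound:
  fixes x :: real
  assumes "x \<ge> 1"
  shows "(x + 1/2) * (ln (x + 1/2) - 1) - (x - 1/2) * (ln (x - 1/2) - 1) \<le> ln x"
proof -
  define \<phi> where "\<phi> t = (x + t) * (ln (x + t) - 1) - (x - t) * (ln (x - t) - 1) - 2 * t * ln x" for t
  have "\<phi> (1/2) \<le> \<phi> 0"
  proof (rule DERIV_nonpos_imp_nonincreasing[where f = \<phi>])
    fix t :: real assume t: "0 \<le> t" "t \<le> 1/2"
    have "(\<phi> has_real_derivative (ln (x + t) + ln (x - t) - 2 * ln x)) (at t)"
    proof -
      have "((\<lambda>t. (x + t) * (ln (x + t) - 1)) has_real_derivative ln (x + t) * 1) (at t)"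
        by (rule DERIV_chain2[OF has_real_derivative_xlnx])
           (use t assms in \<open>auto intro!: derivative_eq_intros\<close>)
      moreover have "((\<lambda>t. (x - t) * (ln (x - t) - 1)) has_real_derivative ln (x - t) * (- 1)) (at t)"
        by (rule DERIV_chain2[OF has_real_derivative_xlnx])
           (use t assms in \<open>auto intro!: derivative_eq_intros\<close>)
      ultimately show ?thesis
        unfolding \<phi>_def
        by (rule DERIV_diff[OF DERIV_diff, THEN DERIV_cong]) (auto intro!: derivative_eq_intros)
    qed
    moreover have "ln (x + t) + ln (x - t) \<le> 2 * ln x"
    proof -
      have "ln (x + t) + ln (x - t) = ln ((x + t) * (x - t))"
        using t assms by (subst ln_mult) auto
      also have "\<dots> \<le> ln (x * x)"
        using t assms mult_pos_pos[of "x + t" "x - t"] by (subst ln_le_cancel_iff) (auto simp: algebra_simps)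
      also have "\<dots> = 2 * ln x" using assms by (subst ln_mult) auto
      finally show ?thesis .
    qed
    ultimately show "\<exists>y. (\<phi> has_real_derivative y) (at t) \<and> y \<le> 0"
      by force
  qed simp
  then show ?thesis by (simp add: \<phi>_def)
qed

text \<open>The induction step is the midpoint bound for the integral of \<open>ln\<close> over \<open>[k + 1/2, k + 3/2]\<close>.\<close>

lemma half_integer_power_le_ln_fact:
  "(real k + 1/2) * (ln (real k + 1/2) - 1) \<le> ln (fact k) - ln 2"
proof (induction k)
  case 0
  \<comment> \<open>The case \<open>k = 0\<close> is equivalent to this. The \<open>ln 2\<close>
    subtracted in the claim becomes the factor 1/2 in \<open>sqrt_mult_poi_le\<close>.\<close>
  have "ln (2::real) \<le> 1" using ln_le_minus_one[of "2::real"] by simp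
  then show ?case by (simp add: ln_div)
next
  case (Suc k)
  have "ln (fact (Suc k)) = ln (real (Suc k)) + ln (fact k :: real)"
    by (simp add: ln_mult)
  then show ?case
    using xlnx_midpoint_bound[of "real (Suc k)"] Suc by (simp add: algebra_simps)
qed

section \<open>Poisson masses and tails\<close>

context
  fixes lam :: real
  assumes lam_pos: "lam > 0"
begin

abbreviation "poi \<equiv> pmf (poisson_pmf lam)"
abbreviation "Poi \<equiv> measure_pmf.prob (poisson_pmf lam)"

lemma poi_pos: "poi k > 0"
  using lam_pos by (simp add: pmf_poisson)

lemma poi_Suc: "real (Suc k) * poi (Suc k) = lam * poi k"
proof -
  have "fact (Suc k) = real (Suc k) * fact k" by simp
  then show ?thesis
    using lam_pos unfolding pmf_poisson[OF lam_pos]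
    by (simp only: divide_simps) simp
qed

text \<open>As a function of \<open>lam\<close>, the left-hand side is maximal at \<open>lam = k + 1/2\<close>.\<close>

lemma sqrt_mult_poi_le: "sqrt lam * poi k \<le> 1/2"
proof -
  let ?x = "real k + 1/2"
  \<comment> \<open>This inequality is tight exactly at the maximiser \<open>lam = ?x\<close>. The
    1/2 in \<open>?x\<close> is the exponent contributed by \<open>sqrt lam\<close>.\<close>
  have "ln (lam / ?x) \<le> lam / ?x - 1"
    using lam_pos by (intro ln_le_minus_one) auto
  then have "?x * (ln lam - ln ?x) \<le> ?x * (lam / ?x - 1)"
    using lam_pos by (intro mult_left_mono) (auto simp: ln_div)
  also have "?x * (lam / ?x - 1) = lam - ?x"
    by (simp only: right_diff_distrib) simp
  finally have "?x * ln lam - lam \<le> ?x * (ln ?x - 1)"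
    by (simp add: right_diff_distrib)
  also note half_integer_power_le_ln_fact[of k]
  also have "?x * ln lam - lam = ln (sqrt lam * poi k) + ln (fact k)"
    using lam_pos by (simp add: pmf_poisson ln_mult ln_div ln_sqrt ln_realpow algebra_simps)
  finally have "ln (sqrt lam * poi k) \<le> ln (1/2)"
    by (simp add: ln_div)
  then show ?thesis
    using lam_pos poi_pos[of k] by (subst (asm) ln_le_cancel_iff) auto
qed

lemma Poi_atMost: "Poi {..k} = (\<Sum>i\<le>k. poi i)"
  by (simp add: measure_measure_pmf_finite)

lemma poi_sums: "poi sums 1"
proof -
  have "(\<lambda>k. Poi {k}) sums Poi (\<Union>k. {k})"
    by (rule measure_pmf.finite_measure_UNION) (auto simp: disjoint_family_on_def)
  then show ?thesis by (simp add: measure_pmf_single)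
qed

lemma Poi_greaterThan: "Poi {k<..} = 1 - Poi {..k}"
  by (subst measure_pmf.prob_compl[symmetric]) (auto intro!: arg_cong[where f=Poi])

lemma Poi_greaterThan_sums: "(\<lambda>i. poi (i + Suc k)) sums Poi {k<..}"
  using poi_sums unfolding Poi_greaterThan Poi_atMost
  by (subst lessThan_Suc_atMost[symmetric], subst sums_iff_shift) simp

text \<open>By \<open>poi_Suc\<close> the left-hand side is the sum of \<open>j * poi j\<close> for
  \<open>j\<close> from 1 to \<open>Suc k\<close>, and every factor \<open>j\<close> is at most
  \<open>Suc k\<close>. Keeping track of the missing \<open>poi 0\<close> later yields the numerator
  \<open>1 - poi 0\<close> in \<open>stein_sol_diff_le\<close>.\<close>

lemma lam_Poi_atMost: "lam * Poi {..k} \<le> real (Suc k) * (Poi {..Suc k} - poi 0)"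
proof -
  have "lam * Poi {..k} = (\<Sum>i\<le>k. real (Suc i) * poi (Suc i))"
    by (simp only: Poi_atMost sum_distrib_left poi_Suc)
  also have "\<dots> \<le> (\<Sum>i\<le>k. real (Suc k) * poi (Suc i))"
    by (intro sum_mono mult_right_mono) auto
  also have "\<dots> = real (Suc k) * (Poi {..Suc k} - poi 0)"
    unfolding Poi_atMost sum.atMost_Suc_shift by (simp add: sum_distrib_left)
  finally show ?thesis .
qed

text \<open>The mirror image for upper tails: here the factors coming from \<open>poi_Suc\<close>
  are at least \<open>Suc k\<close>.\<close>

lemma lam_Poi_greaterThan: "real (Suc k) * Poi {Suc k<..} \<le> lam * Poi {k<..}"
proof -
  have "(\<lambda>i. real (Suc k) * poi (i + Suc (Suc k))) sums (real (Suc k) * Poi {Suc k<..})"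
    by (intro sums_mult Poi_greaterThan_sums)
  moreover have "(\<lambda>i. lam * poi (i + Suc k)) sums (lam * Poi {k<..})"
    by (intro sums_mult Poi_greaterThan_sums)
  moreover have "real (Suc k) * poi (i + Suc (Suc k)) \<le> lam * poi (i + Suc k)" for i
    unfolding poi_Suc[symmetric] add_Suc_right by (intro mult_right_mono) auto
  ultimately show ?thesis by (rule sums_le[rotated 1])
qed

text \<open>
  The difference \<open>g k\<close> of the two sides has increments \<open>poi k * s k\<close> with \<open>s\<close> decreasing, so
  \<open>g\<close>, started from \<open>0\<close> at \<open>k = -1\<close>, first increases and then decreases to its limit \<open>0\<close>.
\<close>

lemma Poi_atMost_mult_greaterThan_le:
  assumes c: "\<And>k. lam * (poi k + poi (Suc k)) \<le> c"
  shows "Poi {..k} * Poi {k<..} \<le> c * poi k"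
proof -
  define g where "g k = c * poi k - Poi {..k} * Poi {k<..}" for k
  \<comment> \<open>For \<open>k > 0\<close> the factor \<open>1 - k / lam\<close> encodes
    \<open>poi k - poi (k - 1)\<close>, since \<open>k * poi k = lam * poi (k - 1)\<close>. The
    remaining terms come from the increment of the product of the two tails.\<close>
  define s where "s k = c * (1 - real k / lam) - 1 + 2 * Poi {..k} - poi k" for k
  have Suc_P: "Poi {..Suc k} = Poi {..k} + poi (Suc k)" for k
    by (simp only: Poi_atMost sum.atMost_Suc)
  have g0: "g 0 = poi 0 * s 0"
    by (simp only: g_def s_def Poi_greaterThan Poi_atMost) (simp add: algebra_simps)
  have gSuc: "g (Suc k) = g k + poi (Suc k) * s (Suc k)" for k
  proof -
    have "poi (Suc k) * (c * (1 - real (Suc k) / lam)) = c * poi (Suc k) - c * (real (Suc k) * poi (Suc k)) / lam"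
      by (simp add: algebra_simps add_divide_distrib)
    also have "\<dots> = c * poi (Suc k) - c * poi k"
      using lam_pos by (simp only: poi_Suc) simp
    finally have "poi (Suc k) * s (Suc k) = c * poi (Suc k) - c * poi k + poi (Suc k) * (2 * Poi {..k} + poi (Suc k) - 1)"
      unfolding s_def Suc_P by (simp only: ring_distribs)
    then show ?thesis
      unfolding g_def Poi_greaterThan Suc_P by (simp add: algebra_simps)
  qed
  \<comment> \<open>This is equivalent to the hypothesis on \<open>c\<close>, which explains the two
    adjacent masses there.\<close>
  have "s (Suc k) \<le> s k" for k
  proof -
    have "s (Suc k) - s k = poi k + poi (Suc k) - c / lam"
      unfolding s_def Suc_P by (simp add: add_divide_distrib algebra_simps)
    also have "\<dots> \<le> 0" using c[of k] lam_pos by (simp only: field_simps)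
    finally show ?thesis by simp
  qed
  then have s_anti: "s j \<le> s i" if "i \<le> j" for i j
    using that by (rule lift_Suc_antimono_le)
  have "g k \<ge> 0"
  proof (cases "s k \<ge> 0")
    case True
    have "g j \<ge> 0" if "j \<le> k" for j using that
    proof (induction j)
      case 0
      then show ?case using True s_anti[of 0 k] poi_pos[of 0] by (simp only: g0) simp
    next
      case (Suc j)
      then show ?case using True s_anti[of "Suc j" k] poi_pos[of "Suc j"] by (simp only: gSuc) simp
    qed
    then show ?thesis by simp
  next
    case False
    have "g (i + k) \<le> g k" for i
    proof (induction i)
      case (Suc i)
      have "s (Suc (i + k)) \<le> 0" using False s_anti[of k "Suc (i + k)"] by simp
      then have "poi (Suc (i + k)) * s (Suc (i + k)) \<le> 0"
        using poi_pos[of "Suc (i + k)"] by (intro mult_nonneg_nonpos) auto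
      then show ?case using Suc gSuc[of "i + k"] by simp
    qed simp
    moreover have "g \<longlonglongrightarrow> c * 0 - 1 * (1 - 1)"
      unfolding g_def Poi_greaterThan Poi_atMost
      using poi_sums summable_LIMSEQ_zero[OF sums_summable[OF poi_sums]]
      by (intro tendsto_intros) (auto simp: sums_def_le)
    then have "(\<lambda>i. g (i + k)) \<longlonglongrightarrow> 0"
      by (simp add: LIMSEQ_ignore_initial_segment)
    ultimately show ?thesis by (rule_tac LIMSEQ_le_const2) auto
  qed
  then show ?thesis by (simp add: g_def)
qed

section \<open>The Stein equation and bounds on its solution\<close>

text \<open>The Stein equation leaves the value at \<open>0\<close> free.\<close>

definition stein_sol :: "nat set \<Rightarrow> nat \<Rightarrow> real" where
  "stein_sol A k = (case k of 0 \<Rightarrow> 0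
     | Suc j \<Rightarrow> (Poi (A \<inter> {..j}) - Poi A * Poi {..j}) / (lam * poi j))"

lemma Poi_Int_atMost_Suc: "Poi (A \<inter> {..Suc k}) = Poi (A \<inter> {..k}) + indicator A (Suc k) * poi (Suc k)"
proof -
  have "Poi (A \<inter> {..Suc k}) = Poi (A \<inter> {..k}) + Poi (A \<inter> {Suc k})"
    by (subst measure_pmf.finite_measure_Union[symmetric])
       (auto intro!: arg_cong[where f=Poi] simp: le_Suc_eq)
  then show ?thesis by (simp add: indicator_def measure_pmf_single)
qed

text \<open>For \<open>k > 0\<close> both terms have denominator \<open>poi k\<close>, because
  \<open>lam * poi (k - 1) = k * poi k\<close>. Their numerators differ by the mass
  \<open>poi k\<close> times the right-hand side.\<close>

lemma stein_equation:
  "lam * stein_sol A (Suc k) - real k * stein_sol A k = indicator A k - Poi A"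
proof (cases k)
  case 0
  have "Poi (A \<inter> {0}) = indicator A 0 * poi 0"
    by (simp add: indicator_def measure_pmf_single)
  moreover have "{..0::nat} = {0}" by auto
  ultimately show ?thesis
    using 0 lam_pos poi_pos[of 0] by (simp add: stein_sol_def measure_pmf_single field_simps)
next
  case (Suc j)
  let ?n = "\<lambda>j. Poi (A \<inter> {..j}) - Poi A * Poi {..j}"
  have "real (Suc j) * stein_sol A (Suc j) = ?n j / poi (Suc j)"
    using poi_Suc[of j, symmetric] poi_pos[of "Suc j"] by (simp add: stein_sol_def)
  moreover have "lam * stein_sol A (Suc (Suc j)) = ?n (Suc j) / poi (Suc j)"
    using lam_pos by (simp add: stein_sol_def)
  \<comment> \<open>The instance \<open>UNIV\<close> supplies the recursion for
    \<open>Poi {..j}\<close> itself.\<close>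
  moreover have "?n (Suc j) = ?n j + poi (Suc j) * (indicator A (Suc j) - Poi A)"
    using Poi_Int_atMost_Suc[of A j] Poi_Int_atMost_Suc[of UNIV j] by (simp add: algebra_simps)
  ultimately have "lam * stein_sol A (Suc k) - real k * stein_sol A k
      = (?n j + poi (Suc j) * (indicator A (Suc j) - Poi A)) / poi (Suc j) - ?n j / poi (Suc j)"
    unfolding Suc by simp
  then show ?thesis
    using poi_pos[of "Suc j"] Suc by (simp add: add_divide_distrib)
qed

lemma Poi_split_atMost: "Poi A = Poi (A \<inter> {..k}) + Poi (A \<inter> {k<..})"
  by (subst measure_pmf.finite_measure_Union[symmetric]) (auto intro!: arg_cong[where f=Poi])

text \<open>Splitting \<open>Poi A\<close> at \<open>k\<close> separates the points of
  \<open>A\<close> up to \<open>k\<close>, which contribute positively, from those beyond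
  \<open>k\<close>, which contribute negatively. Both bounds on the solution rest on these
  signs.\<close>

lemma stein_sol_Suc:
  "stein_sol A (Suc k) =
     (Poi (A \<inter> {..k}) * Poi {k<..} - Poi (A \<inter> {k<..}) * Poi {..k}) / (lam * poi k)"
  using Poi_split_atMost[of A k] by (simp add: stein_sol_def Poi_greaterThan algebra_simps)

text \<open>Passing to the complement turns the upper bound on increments into a lower
  bound.\<close>

lemma stein_sol_compl: "stein_sol (- A) k = - stein_sol A k"
proof (cases k)
  case (Suc j)
  have "Poi (- A) = 1 - Poi A"
    by (subst measure_pmf.prob_compl[symmetric]) (auto simp: Compl_eq_Diff_UNIV)
  moreover have "Poi (- A \<inter> {..j}) = Poi {..j} - Poi (A \<inter> {..j})"
    by (subst (2) Int_commute, subst measure_pmf.finite_measure_Diff'[symmetric])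
       (auto intro!: arg_cong[where f=Poi])
  ultimately have "Poi (- A \<inter> {..j}) - Poi (- A) * Poi {..j} = - (Poi (A \<inter> {..j}) - Poi A * Poi {..j})"
    by (simp only:) (simp add: algebra_simps)
  then show ?thesis
    unfolding Suc stein_sol_def by (simp add: minus_divide_left)
qed (simp add: stein_sol_def)

text \<open>The numerator in \<open>stein_sol_Suc\<close> is a difference of two numbers between 0
  and the product of the tails. The maximum reflects two bounds on
  \<open>poi k + poi (Suc k)\<close>: total mass 1, and twice
  \<open>sqrt_mult_poi_le\<close>.\<close>

lemma stein_sol_bound: "\<bar>stein_sol A k\<bar> \<le> 1 / max 1 (sqrt lam)"
proof (cases k)
  case (Suc j)
  have "Poi {..j} * Poi {j<..} \<le> (lam / max 1 (sqrt lam)) * poi j"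
  proof (rule Poi_atMost_mult_greaterThan_le)
    fix k
    have "poi k + poi (Suc k) \<le> 1"
      using measure_pmf.prob_le_1[of "poisson_pmf lam" "{k, Suc k}"]
      by (simp add: measure_measure_pmf_finite)
    moreover have "sqrt lam * (poi k + poi (Suc k)) \<le> 1"
      using sqrt_mult_poi_le[of k] sqrt_mult_poi_le[of "Suc k"] by (simp add: distrib_left)
    ultimately have "max 1 (sqrt lam) * (poi k + poi (Suc k)) \<le> 1"
      by (simp add: max_def)
    then have "poi k + poi (Suc k) \<le> 1 / max 1 (sqrt lam)"
      by (subst pos_le_divide_eq) (auto simp: mult.commute)
    then show "lam * (poi k + poi (Suc k)) \<le> lam / max 1 (sqrt lam)"
      using mult_left_mono[OF _ less_imp_le[OF lam_pos]] by fastforce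
  qed
  moreover have "\<bar>Poi (A \<inter> {..j}) * Poi {j<..} - Poi (A \<inter> {j<..}) * Poi {..j}\<bar> \<le> Poi {..j} * Poi {j<..}"
  proof -
    have "Poi (A \<inter> {..j}) * Poi {j<..} \<le> Poi {..j} * Poi {j<..}"
      by (intro mult_right_mono measure_pmf.finite_measure_mono) auto
    moreover have "Poi (A \<inter> {j<..}) * Poi {..j} \<le> Poi {j<..} * Poi {..j}"
      by (intro mult_right_mono measure_pmf.finite_measure_mono) auto
    moreover have "0 \<le> Poi (A \<inter> {..j}) * Poi {j<..}" "0 \<le> Poi (A \<inter> {j<..}) * Poi {..j}"
      by auto
    ultimately show ?thesis unfolding abs_le_iff mult.commute[of "Poi {j<..}" "Poi {..j}"] by linarith
  qed
  ultimately have "\<bar>Poi (A \<inter> {..j}) * Poi {j<..} - Poi (A \<inter> {j<..}) * Poi {..j}\<bar>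
      \<le> (1 / max 1 (sqrt lam)) * (lam * poi j)" by simp
  moreover have "lam * poi j > 0" using lam_pos poi_pos[of j] by (rule mult_pos_pos)
  ultimately show ?thesis
    unfolding Suc stein_sol_Suc abs_divide by (subst pos_divide_le_eq) auto
qed (simp add: stein_sol_def)

text \<open>
  Only the mass of \<open>A\<close> at \<open>Suc k\<close> can make the increment positive; the masses of \<open>A\<close> to the
  left and to the right of it contribute nonpositive terms.
\<close>

lemma stein_sol_diff_le: "stein_sol A (Suc (Suc k)) - stein_sol A (Suc k) \<le> (1 - poi 0) / lam"
proof -
  let ?P = "Poi {..k}" and ?P' = "Poi {..Suc k}" and ?Q = "Poi {k<..}" and ?Q' = "Poi {Suc k<..}"
  define a where "a = Poi (A \<inter> {..k})"
  define b where "b = Poi (A \<inter> {Suc k<..})"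
  define e where "e = indicat_real A (Suc k)"
  define \<pi> where "\<pi> = poi (Suc k)"
  have \<pi>: "\<pi> > 0" unfolding \<pi>_def by (rule poi_pos)
  have ab: "a \<ge> 0" "b \<ge> 0" "0 \<le> e" "e \<le> 1" by (auto simp: a_def b_def e_def indicator_def)
  have 1: "Poi (A \<inter> {..Suc k}) = a + e * \<pi>"
    unfolding a_def e_def \<pi>_def by (rule Poi_Int_atMost_Suc)
  have 2: "Poi (A \<inter> {k<..}) = e * \<pi> + b"
    using Poi_split_atMost[of A k] Poi_split_atMost[of A "Suc k"] 1 by (simp add: a_def b_def)
  \<comment> \<open>Hence the denominators are \<open>lam * \<pi>\<close> and
    \<open>?m * \<pi>\<close>, and \<open>lam * ?m * \<pi>\<close> clears both.\<close>
  have lp: "lam * poi k = real (Suc k) * \<pi>" unfolding \<pi>_def by (rule poi_Suc[symmetric])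
  let ?m = "real (Suc k)"
  have "lam * \<pi> * stein_sol A (Suc (Suc k)) = (a + e * \<pi>) * ?Q' - b * ?P'"
    using lam_pos \<pi> by (simp add: stein_sol_Suc 1 b_def \<pi>_def)
  moreover have "?m * \<pi> * stein_sol A (Suc k) = a * ?Q - (e * \<pi> + b) * ?P"
    unfolding lp[symmetric] stein_sol_Suc 2 a_def using lam_pos poi_pos[of k] by simp
  moreover have "lam * ?m * \<pi> * (x - y) = ?m * (lam * \<pi> * x) - lam * (?m * \<pi> * y)" for x y
    by (simp only: algebra_simps)
  ultimately have "lam * ?m * \<pi> * (stein_sol A (Suc (Suc k)) - stein_sol A (Suc k))
     = ?m * ((a + e * \<pi>) * ?Q' - b * ?P') - lam * (a * ?Q - (e * \<pi> + b) * ?P)"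
    by simp
  \<comment> \<open>Collecting by \<open>a\<close>, \<open>b\<close> and \<open>e\<close> isolates
    the three groups of points of \<open>A\<close>; the tail inequalities fix the signs of the first
    two coefficients.\<close>
  also have "\<dots> = a * (?m * ?Q' - lam * ?Q) + b * (lam * ?P - ?m * ?P') + e * \<pi> * (?m * ?Q' + lam * ?P)"
    by (simp only: algebra_simps)
  also have "\<dots> \<le> 0 + 0 + 1 * \<pi> * (?m * (1 - poi 0))"
  proof (intro add_mono mult_mono)
    show "a * (?m * ?Q' - lam * ?Q) \<le> 0"
      using ab lam_Poi_greaterThan[of k] by (intro mult_nonneg_nonpos) auto
    have "lam * ?P \<le> ?m * (?P' - poi 0)" by (rule lam_Poi_atMost)
    also have "\<dots> \<le> ?m * ?P'" using poi_pos[of 0] by (intro mult_left_mono) auto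
    finally show "b * (lam * ?P - ?m * ?P') \<le> 0"
      using ab by (intro mult_nonneg_nonpos) auto
    \<comment> \<open>With \<open>?Q' = 1 - ?P'\<close>, the mass \<open>?P'\<close> cancels against
      the one in \<open>lam_Poi_atMost\<close>.\<close>
    show "?m * ?Q' + lam * ?P \<le> ?m * (1 - poi 0)"
      using lam_Poi_atMost[of k] unfolding Poi_greaterThan by (simp only: algebra_simps)
  qed (use ab \<pi> lam_pos in auto)
  also have "\<dots> = lam * ?m * \<pi> * ((1 - poi 0) / lam)"
    using lam_pos by simp
  finally show ?thesis
    by (subst (asm) mult_le_cancel_left_pos) (use lam_pos \<pi> in auto)
qed

text \<open>Applies the one-sided bound to \<open>A\<close> and to its complement;
  \<open>1 - poi 0 = 1 - exp (- lam)\<close> is at most both 1 and \<open>lam\<close>.\<close>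

lemma stein_sol_diff_bound: "\<bar>stein_sol A (Suc (Suc k)) - stein_sol A (Suc k)\<bar> \<le> 1 / max 1 lam"
proof -
  have "\<bar>stein_sol A (Suc (Suc k)) - stein_sol A (Suc k)\<bar> \<le> (1 - poi 0) / lam"
    using stein_sol_diff_le[of A k] stein_sol_diff_le[of "- A" k]
    unfolding stein_sol_compl by linarith
  also have "\<dots> \<le> 1 / max 1 lam"
  proof -
    have "1 - poi 0 \<le> lam" using lam_pos exp_ge_add_one_self[of "- lam"] by (simp add: pmf_poisson)
    moreover have "1 - poi 0 \<le> 1" using poi_pos[of 0] by simp
    ultimately show ?thesis
      using lam_pos by (simp add: max_def field_simps)
  qed
  finally show ?thesis .
qed

text \<open>Telescoping. Arguments start at 1 because the value at 0 is a convention outside the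
  increment bound.\<close>

lemma stein_sol_lipschitz:
  "\<bar>stein_sol A (Suc (j + k)) - stein_sol A (Suc j)\<bar> \<le> real k / max 1 lam"
proof (induction k)
  case (Suc k)
  have "real (Suc k) / max 1 lam = real k / max 1 lam + 1 / max 1 lam"
    by (simp add: add_divide_distrib)
  then show ?case using Suc stein_sol_diff_bound[of A "j + k"] unfolding add_Suc_right by linarith
qed simp

end

section \<open>Expectations under laws on the naturals\<close>

lemma nat_distr_eq_density:
  assumes "prob_space M" and X: "X \<in> measurable M (count_space (UNIV :: nat set))"
  shows "distr M (count_space UNIV) X
    = density (count_space UNIV) (\<lambda>k. ennreal (measure M {\<omega> \<in> space M. X \<omega> = k}))"
proof (rule measure_eqI_countable)
  interpret prob_space M by fact
  fix k :: nat
  have "X -` {k} \<inter> space M = {\<omega> \<in> space M. X \<omega> = k}" by auto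
  then show "emeasure (distr M (count_space UNIV) X) {k}
    = emeasure (density (count_space UNIV) (\<lambda>k. ennreal (measure M {\<omega> \<in> space M. X \<omega> = k}))) {k}"
    using X by (simp add: emeasure_distr emeasure_density emeasure_eq_measure
        nn_integral_count_space_indicator[symmetric] nn_integral_count_space_finite)
qed auto

context prob_space
begin

lemma integrable_nat_law_iff:
  fixes f :: "nat \<Rightarrow> real"
  assumes X: "random_variable (count_space UNIV) X"
    and p: "\<And>k. prob {\<omega> \<in> space M. X \<omega> = k} = p k"
  shows "integrable M (\<lambda>\<omega>. f (X \<omega>)) \<longleftrightarrow> summable (\<lambda>k. norm (p k * f k))"
proof -
  have p0: "p k \<ge> 0" for k by (simp flip: p)
  have "integrable M (\<lambda>\<omega>. f (X \<omega>)) \<longleftrightarrow> integrable (distr M (count_space UNIV) X) f"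
    by (subst integrable_distr_eq[OF X]) auto
  also have "\<dots> \<longleftrightarrow> integrable (count_space UNIV) (\<lambda>k. p k * f k)"
    unfolding nat_distr_eq_density[OF prob_space_axioms X] p
    by (subst integrable_density) (auto simp: p0)
  finally show ?thesis by (simp add: integrable_count_space_nat_iff)
qed

lemma expectation_nat_law_sums:
  fixes f :: "nat \<Rightarrow> real"
  assumes X: "random_variable (count_space UNIV) X"
    and p: "\<And>k. prob {\<omega> \<in> space M. X \<omega> = k} = p k"
    and f: "integrable M (\<lambda>\<omega>. f (X \<omega>))"
  shows "(\<lambda>k. p k * f k) sums expectation (\<lambda>\<omega>. f (X \<omega>))"
proof -
  have p0: "p k \<ge> 0" for k by (simp flip: p)
  have "expectation (\<lambda>\<omega>. f (X \<omega>)) = integral\<^sup>L (distr M (count_space UNIV) X) f"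
    by (subst integral_distr[OF X]) auto
  also have "\<dots> = integral\<^sup>L (count_space UNIV) (\<lambda>k. p k * f k)"
    unfolding nat_distr_eq_density[OF prob_space_axioms X] p
    by (subst integral_density) (auto simp: p0)
  finally show ?thesis
    using f integrable_nat_law_iff[OF X p, of f]
    by (simp add: sums_integral_count_space_nat integrable_count_space_nat_iff)
qed

text \<open>Conditioning on the value of \<open>X\<close>: independence makes the joint law a
  product, and Fubini's theorem integrates out \<open>Y\<close> first.\<close>

lemma expectation_indep_nat_sums:
  fixes \<phi> :: "nat \<Rightarrow> nat \<Rightarrow> real"
  assumes ind: "indep_var (count_space UNIV) X (count_space UNIV) Y"
    and p: "\<And>k. prob {\<omega> \<in> space M. X \<omega> = k} = p k"
    and \<phi>: "integrable M (\<lambda>\<omega>. \<phi> (X \<omega>) (Y \<omega>))"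
  shows "(\<lambda>k. p k * expectation (\<lambda>\<omega>. \<phi> k (Y \<omega>))) sums expectation (\<lambda>\<omega>. \<phi> (X \<omega>) (Y \<omega>))"
proof -
  let ?C = "count_space (UNIV :: nat set)"
  let ?X = "distr M ?C X" and ?Y = "distr M ?C Y"
  have X: "random_variable ?C X" and Y: "random_variable ?C Y"
    and XY: "?X \<Otimes>\<^sub>M ?Y = distr M (?C \<Otimes>\<^sub>M ?C) (\<lambda>\<omega>. (X \<omega>, Y \<omega>))"
    using ind by (auto simp: indep_var_distribution_eq)
  interpret X: prob_space ?X by (rule prob_space_distr) fact
  interpret Y: prob_space ?Y by (rule prob_space_distr) fact
  interpret P: pair_sigma_finite ?X ?Y ..
  have m: "(\<lambda>\<omega>. (X \<omega>, Y \<omega>)) \<in> measurable M (?C \<Otimes>\<^sub>M ?C)" using X Y by measurable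
  \<comment> \<open>On a product of countable discrete spaces every function is measurable.\<close>
  have \<phi>m: "case_prod \<phi> \<in> borel_measurable (?C \<Otimes>\<^sub>M ?C)"
    by (simp add: pair_measure_countable)
  have int: "integrable (?X \<Otimes>\<^sub>M ?Y) (case_prod \<phi>)"
    unfolding XY using \<phi> by (subst integrable_distr_eq[OF m \<phi>m]) simp
  have E: "(\<integral>y. \<phi> x y \<partial>?Y) = expectation (\<lambda>\<omega>. \<phi> x (Y \<omega>))" for x
    by (rule integral_distr[OF Y]) simp
  have "integrable M (\<lambda>\<omega>. expectation (\<lambda>\<omega>'. \<phi> (X \<omega>) (Y \<omega>')))"
    using P.integrable_fst'[OF int] unfolding E prod.case by (subst (asm) integrable_distr_eq[OF X]) auto
  from expectation_nat_law_sums[OF X p this]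
  have "(\<lambda>k. p k * expectation (\<lambda>\<omega>. \<phi> k (Y \<omega>))) sums
      expectation (\<lambda>\<omega>. expectation (\<lambda>\<omega>'. \<phi> (X \<omega>) (Y \<omega>')))" .
  also have "expectation (\<lambda>\<omega>. expectation (\<lambda>\<omega>'. \<phi> (X \<omega>) (Y \<omega>'))) = (\<integral>x. (\<integral>y. \<phi> x y \<partial>?Y) \<partial>?X)"
    unfolding E by (subst integral_distr[OF X]) auto
  also have "\<dots> = integral\<^sup>L (?X \<Otimes>\<^sub>M ?Y) (case_prod \<phi>)"
    using P.integral_fst'[OF int] by simp
  also have "\<dots> = expectation (\<lambda>\<omega>. \<phi> (X \<omega>) (Y \<omega>))"
    unfolding XY by (subst integral_distr[OF m \<phi>m]) simp
  finally show ?thesis .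
qed

text \<open>Both variables are functions of subfamilies with disjoint index sets, \<open>{i}\<close>
  and \<open>I - {i}\<close>.\<close>

lemma indep_var_sum_nat:
  fixes X :: "'i \<Rightarrow> 'a \<Rightarrow> nat"
  assumes ind: "indep_vars (\<lambda>_. count_space UNIV) X I" and i: "i \<in> I" and I: "finite I"
  shows "indep_var (count_space UNIV) (X i) (count_space UNIV) (\<lambda>\<omega>. \<Sum>j\<in>I - {i}. X j \<omega>)"
proof -
  let ?C = "count_space (UNIV :: nat set)"
  have "indep_var ?C ((\<lambda>f. f i) \<circ> (\<lambda>\<omega>. restrict (\<lambda>i. X i \<omega>) {i}))
      ?C ((\<lambda>f. \<Sum>j\<in>I - {i}. f j) \<circ> (\<lambda>\<omega>. restrict (\<lambda>i. X i \<omega>) (I - {i})))"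
    using i I
    by (intro indep_var_compose[OF indep_var_restrict[OF ind]] measurable_sum_nat) auto
  also have "(\<lambda>f. f i) \<circ> (\<lambda>\<omega>. restrict (\<lambda>i. X i \<omega>) {i}) = X i" by auto
  also have "(\<lambda>f. \<Sum>j\<in>I - {i}. f j) \<circ> (\<lambda>\<omega>. restrict (\<lambda>i. X i \<omega>) (I - {i})) = (\<lambda>\<omega>. \<Sum>j\<in>I - {i}. X j \<omega>)"
    by (auto cong: rev_conj_cong)
  finally show ?thesis .
qed

end

section \<open>Comparison of a law with its shifted size-biased law\<close>

lemma ennreal_abs_sums_le:
  fixes x :: "nat \<Rightarrow> real"
  assumes "x sums D"
  shows "ennreal \<bar>D\<bar> \<le> (\<Sum>k. ennreal \<bar>x k\<bar>)"
\<comment> \<open>An infinite right-hand side makes the claim trivial; otherwise the series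
  converges absolutely.\<close>
proof (cases "(\<Sum>k. ennreal \<bar>x k\<bar>) = top")
  case False
  then have s: "summable (\<lambda>k. \<bar>x k\<bar>)"
    by (intro summable_suminf_not_top) auto
  then show ?thesis
    using summable_rabs[OF s] assms by (simp add: suminf_ennreal2 sums_iff ennreal_leI)
qed simp

text \<open>Both expectations become series over the same numbers \<open>m k\<close>, with weights
  \<open>\<mu> * p k\<close> and \<open>\<mu> * q k\<close>. The bound \<open>B\<close> only secures
  integrability; the size of the estimate comes from \<open>lipschitz\<close>.\<close>

lemma (in prob_space) size_bias_discrepancy:
  fixes f :: "nat \<Rightarrow> real"
  assumes ind: "indep_var (count_space UNIV) X (count_space UNIV) W"
    and p: "\<And>k. prob {\<omega> \<in> space M. X \<omega> = k} = p k"
    and int: "integrable M (\<lambda>\<omega>. real (X \<omega>))"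
    and q: "q sums 1"
    and size_bias: "\<And>k. real (Suc k) * p (Suc k) = expectation (\<lambda>\<omega>. real (X \<omega>)) * q k"
    and bounded: "\<And>k. \<bar>f k\<bar> \<le> B"
    and lipschitz: "\<And>j k. \<bar>f (Suc (j + k)) - f (Suc j)\<bar> \<le> real k * \<delta>"
    and \<delta>: "\<delta> \<ge> 0"
  shows "ennreal \<bar>expectation (\<lambda>\<omega>. real (X \<omega>)) * expectation (\<lambda>\<omega>. f (Suc (X \<omega> + W \<omega>)))
           - expectation (\<lambda>\<omega>. real (X \<omega>) * f (X \<omega> + W \<omega>))\<bar>
    \<le> ennreal \<delta> * (ennreal (expectation (\<lambda>\<omega>. real (X \<omega>))) *
          (\<Sum>k. ennreal (real (Suc k) * \<bar>p (Suc k) - q (Suc k)\<bar>)))"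
proof -
  define \<mu> where "\<mu> = expectation (\<lambda>\<omega>. real (X \<omega>))"
  define m where "m k = expectation (\<lambda>\<omega>. f (Suc (k + W \<omega>)))" for k
  have X: "random_variable (count_space UNIV) X" and W: "random_variable (count_space UNIV) W"
    using ind by (auto simp: indep_var_distribution_eq)
  have \<mu>: "\<mu> \<ge> 0" by (simp add: \<mu>_def)
  have B: "integrable M (\<lambda>\<omega>. f (g \<omega>))" if "random_variable (count_space UNIV) g" for g
    using that bounded by (intro integrable_const_bound[where B = B]) auto
  have g: "random_variable (count_space UNIV) (\<lambda>\<omega>. k + W \<omega>)"
          "random_variable (count_space UNIV) (\<lambda>\<omega>. X \<omega> + W \<omega>)"
          "random_variable (count_space UNIV) (\<lambda>\<omega>. Suc (k + W \<omega>))"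
          "random_variable (count_space UNIV) (\<lambda>\<omega>. Suc (X \<omega> + W \<omega>))" for k
    using X W by measurable
  have 1: "(\<lambda>k. p k * m k) sums expectation (\<lambda>\<omega>. f (Suc (X \<omega> + W \<omega>)))"
    unfolding m_def using g(4) by (intro expectation_indep_nat_sums[OF ind p] B)
  have "integrable M (\<lambda>\<omega>. real (X \<omega>) * f (X \<omega> + W \<omega>))"
  proof (rule Bochner_Integration.integrable_bound)
    show "integrable M (\<lambda>\<omega>. B * real (X \<omega>))" using int by simp
    show "(\<lambda>\<omega>. real (X \<omega>) * f (X \<omega> + W \<omega>)) \<in> borel_measurable M"
      using X g(2) by measurable
    have "B \<ge> 0" using bounded[of 0] by simp
    then show "AE \<omega> in M. norm (real (X \<omega>) * f (X \<omega> + W \<omega>)) \<le> norm (B * real (X \<omega>))"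
      using bounded by (auto simp: abs_mult mult.commute[of B] intro!: mult_left_mono)
  qed
  from expectation_indep_nat_sums[OF ind p this]
  have "(\<lambda>k. p k * (real k * expectation (\<lambda>\<omega>. f (k + W \<omega>))))
      sums expectation (\<lambda>\<omega>. real (X \<omega>) * f (X \<omega> + W \<omega>))" by simp
  \<comment> \<open>The term at 0 vanishes through its factor \<open>real k\<close>, and the shift
    turns the argument \<open>k + W\<close> into that of \<open>m k\<close>.\<close>
  then have "(\<lambda>k. p (Suc k) * (real (Suc k) * m k))
      sums expectation (\<lambda>\<omega>. real (X \<omega>) * f (X \<omega> + W \<omega>))"
    by (subst (asm) sums_Suc_iff[symmetric, where f = "\<lambda>k. p k * (real k * expectation (\<lambda>\<omega>. f (k + W \<omega>)))", simplified])
       (simp add: m_def)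
  moreover have "p (Suc k) * (real (Suc k) * m k) = \<mu> * q k * m k" for k
    using size_bias[of k] by (simp add: \<mu>_def mult_ac)
  ultimately have 2: "(\<lambda>k. \<mu> * q k * m k) sums expectation (\<lambda>\<omega>. real (X \<omega>) * f (X \<omega> + W \<omega>))"
    by (simp only:)
  have "p sums 1"
    using expectation_nat_law_sums[OF X p, of "\<lambda>_. 1"] by (simp add: prob_space)
  \<comment> \<open>Equal total masses allow \<open>m 0\<close> to be subtracted from every
    \<open>m k\<close>; only differences of \<open>m\<close> are controlled by
    \<open>\<delta>\<close>.\<close>
  then have 3: "(\<lambda>k. \<mu> * m 0 * (p k - q k)) sums (\<mu> * m 0 * (1 - 1))"
    by (intro sums_mult sums_diff q)
  define x where "x k = \<mu> * ((p k - q k) * (m k - m 0))" for k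
  define D where "D = \<mu> * expectation (\<lambda>\<omega>. f (Suc (X \<omega> + W \<omega>)))
    - expectation (\<lambda>\<omega>. real (X \<omega>) * f (X \<omega> + W \<omega>))"
  have "x sums D"
    using sums_diff[OF sums_diff[OF sums_mult[OF 1, of \<mu>] 2] 3]
    by (simp add: x_def[abs_def] D_def algebra_simps)
  \<comment> \<open>Centring at \<open>m 0\<close> makes \<open>x 0\<close> vanish, so the sum
    starts at 1.\<close>
  then have "(\<lambda>k. x (Suc k)) sums D"
    using sums_Suc_iff[of x D] by (simp add: x_def)
  then have "ennreal \<bar>D\<bar> \<le> (\<Sum>k. ennreal \<bar>x (Suc k)\<bar>)"
    by (rule ennreal_abs_sums_le)
  also have "\<dots> \<le> (\<Sum>k. ennreal \<delta> * (ennreal \<mu> * ennreal (real (Suc k) * \<bar>p (Suc k) - q (Suc k)\<bar>)))"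
  proof (intro suminf_le allI summableI)
    fix k
    have "\<bar>m (Suc k) - m 0\<bar> = \<bar>expectation (\<lambda>\<omega>. f (Suc (Suc k + W \<omega>)) - f (Suc (0 + W \<omega>)))\<bar>"
      unfolding m_def by (subst Bochner_Integration.integral_diff) (rule B g refl)+
    also have "\<dots> \<le> expectation (\<lambda>\<omega>. \<bar>f (Suc (Suc k + W \<omega>)) - f (Suc (0 + W \<omega>))\<bar>)"
      by (rule integral_abs_bound)
    also have "\<dots> \<le> expectation (\<lambda>\<omega>. real (Suc k) * \<delta>)"
    proof (intro integral_mono integrable_abs Bochner_Integration.integrable_diff B g)
      show "\<bar>f (Suc (Suc k + W \<omega>)) - f (Suc (0 + W \<omega>))\<bar> \<le> real (Suc k) * \<delta>" for \<omega>
        using lipschitz[of "W \<omega>" "Suc k"] by (simp add: add.commute del: of_nat_Suc)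
    qed simp
    also have "\<dots> = real (Suc k) * \<delta>" by (simp add: prob_space)
    finally have m_le: "\<bar>m (Suc k) - m 0\<bar> \<le> real (Suc k) * \<delta>" .
    have "\<bar>x (Suc k)\<bar> = \<mu> * (\<bar>p (Suc k) - q (Suc k)\<bar> * \<bar>m (Suc k) - m 0\<bar>)"
      using \<mu> by (simp add: x_def abs_mult)
    also have "\<dots> \<le> \<mu> * (\<bar>p (Suc k) - q (Suc k)\<bar> * (real (Suc k) * \<delta>))"
      using \<mu> m_le by (intro mult_left_mono) auto
    also have "\<dots> = \<delta> * (\<mu> * (real (Suc k) * \<bar>p (Suc k) - q (Suc k)\<bar>))"
      by (simp only: mult_ac)
    finally show "ennreal \<bar>x (Suc k)\<bar> \<le> ennreal \<delta> * (ennreal \<mu> * ennreal (real (Suc k) * \<bar>p (Suc k) - q (Suc k)\<bar>))"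
      using \<delta> \<mu> by (simp add: ennreal_mult[symmetric] ennreal_leI del: of_nat_Suc)
  qed
  also have "\<dots> = ennreal \<delta> * (ennreal \<mu> * (\<Sum>k. ennreal (real (Suc k) * \<bar>p (Suc k) - q (Suc k)\<bar>)))"
    by (simp only: ennreal_suminf_cmult)
  finally show ?thesis by (simp only: D_def \<mu>_def)
qed

section \<open>Poisson approximation for sums of power series variables\<close>

theorem theorem3p1:
  fixes n :: nat
    and a :: "nat \<Rightarrow> real"
    and \<theta> :: "nat \<Rightarrow> real"
    and h' :: "real \<Rightarrow> real"
    and lam :: real
    and M :: "'a measure" and X :: "nat \<Rightarrow> 'a \<Rightarrow> nat"
    and M' :: "'b measure" and N :: "'b \<Rightarrow> nat"
  assumes n: "n \<ge> 1"
    and a_nonneg: "\<And>k. a k \<ge> 0"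
    and \<theta>_pos: "\<And>i. i \<in> {1..n} \<Longrightarrow> \<theta> i > 0"
    and h_finite: "\<And>i. i \<in> {1..n} \<Longrightarrow> \<theta> i \<in> convergence_domain a"
    and h_pos: "\<And>i. i \<in> {1..n} \<Longrightarrow> pow_series a (\<theta> i) > 0"
    and h_deriv: "\<And>i. i \<in> {1..n} \<Longrightarrow>
          (pow_series a has_real_derivative h' (\<theta> i)) (at (\<theta> i) within convergence_domain a)"
    and h'_series: "\<And>i. i \<in> {1..n} \<Longrightarrow>
          (\<lambda>k. real (k + 1) * a (k + 1) * \<theta> i ^ k) sums h' (\<theta> i)"
    and h'_pos: "\<And>i. i \<in> {1..n} \<Longrightarrow> h' (\<theta> i) > 0"
    and M: "prob_space M"
    and X_indep: "prob_space.indep_vars M (\<lambda>_. count_space UNIV) X {1..n}"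
    and X_law: "\<And>i k. i \<in> {1..n} \<Longrightarrow>
          measure M {\<omega> \<in> space M. X i \<omega> = k} = ps_mass a (\<theta> i) k"
    and lam_pos: "lam > 0"
    and M': "prob_space M'"
    and N_measurable: "N \<in> measurable M' (count_space UNIV)"
    and N_law: "distr M' (count_space UNIV) N = measure_pmf (poisson_pmf lam)"
  shows "ennreal (tv_dist M (\<lambda>\<omega>. \<Sum>i=1..n. X i \<omega>) M' N)
      \<le> ennreal (\<bar>lam - integral\<^sup>L M (\<lambda>\<omega>. real (\<Sum>i=1..n. X i \<omega>))\<bar> / max 1 (sqrt lam))
        + ennreal (1 / max 1 lam) *
          (\<Sum>i=1..n. ennreal (integral\<^sup>L M (\<lambda>\<omega>. real (X i \<omega>))) *
             (\<Sum>k. ennreal (real (k + 1) *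
                \<bar>ps_mass a (\<theta> i) (k + 1) - ps_mass_star a (h' (\<theta> i)) (\<theta> i) (k + 1)\<bar>)))"
proof -
  interpret prob_space M by (rule M)
  interpret M': prob_space M' by (rule M')
  define S where "S \<omega> = (\<Sum>i=1..n. X i \<omega>)" for \<omega>
  define \<mu> where "\<mu> i = expectation (\<lambda>\<omega>. real (X i \<omega>))" for i
  define p where "p i = ps_mass a (\<theta> i)" for i
  define q where "q i = ps_mass_star a (h' (\<theta> i)) (\<theta> i)" for i
  define \<epsilon> where "\<epsilon> i = ennreal (\<mu> i) * (\<Sum>k. ennreal (real (Suc k) * \<bar>p i (Suc k) - q i (Suc k)\<bar>))" for i
  have X: "random_variable (count_space UNIV) (X i)" if "i \<in> {1..n}" for i
    using X_indep that by (auto simp: indep_vars_def)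
  have S: "random_variable (count_space UNIV) S"
    unfolding S_def using X by (intro measurable_sum_nat)
  \<comment> \<open>The factor in front of \<open>q i k\<close> is the mean of \<open>X i\<close>,
    identified as such in \<open>mean\<close>.\<close>
  have size_bias_eq: "real (Suc k) * p i (Suc k) = (\<theta> i * h' (\<theta> i) / pow_series a (\<theta> i)) * q i k"
    if "i \<in> {1..n}" for i k
  proof -
    have "(\<theta> i * h' (\<theta> i) / pow_series a (\<theta> i)) * (c / h' (\<theta> i)) = \<theta> i * c / pow_series a (\<theta> i)" for c
      using h'_pos[OF that] by simp
    then show ?thesis
      unfolding p_def q_def ps_mass_def ps_mass_star_def by (simp only:) (simp add: mult_ac)
  qed
  have q_sums: "q i sums 1" if i: "i \<in> {1..n}" for i
    using sums_divide[OF h'_series[OF i], of "h' (\<theta> i)"] h'_pos[OF i]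
    by (simp add: q_def ps_mass_star_def[abs_def])
  have mean_sums: "(\<lambda>k. p i k * real k) sums (\<theta> i * h' (\<theta> i) / pow_series a (\<theta> i))"
    if i: "i \<in> {1..n}" for i
  proof -
    have "(\<lambda>k. real (Suc k) * p i (Suc k)) sums (\<theta> i * h' (\<theta> i) / pow_series a (\<theta> i))"
      using sums_mult[OF q_sums[OF i], of "\<theta> i * h' (\<theta> i) / pow_series a (\<theta> i)"]
      by (simp only: size_bias_eq[OF i] mult_1_right)
    then show ?thesis
      using sums_Suc_iff[of "\<lambda>k. p i k * real k"] by (simp add: mult.commute)
  qed
  \<comment> \<open>Finiteness of the mean comes from convergence of the series for
    \<open>h'\<close>.\<close>
  have X_integrable: "integrable M (\<lambda>\<omega>. real (X i \<omega>))" if i: "i \<in> {1..n}" for i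
  proof -
    have "p i k \<ge> 0" for k using X_law[OF i, of k] by (simp add: p_def flip: X_law[OF i])
    then show ?thesis
      using mean_sums[OF i] X_law[OF i]
      by (subst integrable_nat_law_iff[OF X[OF i], where p = "p i"]) (auto simp: p_def sums_iff)
  qed
  have mean: "\<mu> i = \<theta> i * h' (\<theta> i) / pow_series a (\<theta> i)" if i: "i \<in> {1..n}" for i
    using expectation_nat_law_sums[OF X[OF i] X_law[OF i] X_integrable[OF i]] mean_sums[OF i]
    by (auto simp: \<mu>_def p_def intro: sums_unique2)
  \<comment> \<open>The estimate lives in \<open>ennreal\<close> because some
    \<open>\<epsilon> i\<close> may be infinite.\<close>
  have bound: "ennreal \<bar>prob {\<omega> \<in> space M. S \<omega> \<in> A} - measure_pmf.prob (poisson_pmf lam) A\<bar>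
      \<le> ennreal (\<bar>lam - expectation (\<lambda>\<omega>. real (S \<omega>))\<bar> / max 1 (sqrt lam))
        + ennreal (1 / max 1 lam) * (\<Sum>i=1..n. \<epsilon> i)" for A
  proof -
    define f where "f = stein_sol lam A"
    define B where "B = 1 / max 1 (sqrt lam)"
    have f_le: "\<bar>f k\<bar> \<le> B" for k
      unfolding f_def B_def by (rule stein_sol_bound[OF lam_pos])
    have lip: "\<bar>f (Suc (j + k)) - f (Suc j)\<bar> \<le> real k * (1 / max 1 lam)" for j k
      using stein_sol_lipschitz[OF lam_pos] by (simp add: f_def)
    have f_int: "integrable M (\<lambda>\<omega>. f (Suc (S \<omega>)))"
      using S f_le by (intro integrable_const_bound[where B = B]) auto
    have Xf_int: "integrable M (\<lambda>\<omega>. real (X i \<omega>) * f (S \<omega>))" if i: "i \<in> {1..n}" for i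
    proof (rule Bochner_Integration.integrable_bound)
      show "integrable M (\<lambda>\<omega>. B * real (X i \<omega>))" using X_integrable[OF i] by simp
      show "(\<lambda>\<omega>. real (X i \<omega>) * f (S \<omega>)) \<in> borel_measurable M"
        using X[OF i] S by measurable
      have "B \<ge> 0" by (simp add: B_def)
      then show "AE \<omega> in M. norm (real (X i \<omega>) * f (S \<omega>)) \<le> norm (B * real (X i \<omega>))"
        using f_le by (auto simp: abs_mult mult.commute[of B] intro!: mult_left_mono)
    qed
    have ES: "expectation (\<lambda>\<omega>. real (S \<omega>)) = (\<Sum>i=1..n. \<mu> i)"
      unfolding S_def \<mu>_def of_nat_sum using X_integrable by (intro Bochner_Integration.integral_sum)
    define d where "d i = \<mu> i * expectation (\<lambda>\<omega>. f (Suc (S \<omega>))) - expectation (\<lambda>\<omega>. real (X i \<omega>) * f (S \<omega>))" for i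
    have "prob {\<omega> \<in> space M. S \<omega> \<in> A} - measure_pmf.prob (poisson_pmf lam) A
      = expectation (\<lambda>\<omega>. indicator A (S \<omega>) - measure_pmf.prob (poisson_pmf lam) A)"
    proof -
      have [measurable]: "{\<omega> \<in> space M. S \<omega> \<in> A} \<in> events"
        using measurable_sets[OF S, of A] by (simp add: vimage_def Int_def conj_commute)
      have "expectation (\<lambda>\<omega>. indicat_real A (S \<omega>)) = expectation (indicator {\<omega> \<in> space M. S \<omega> \<in> A})"
        by (intro Bochner_Integration.integral_cong) (auto simp: indicator_def)
      moreover have "integrable M (\<lambda>\<omega>. indicat_real A (S \<omega>))"
        using S by (intro integrable_const_bound[where B = 1]) (auto simp: indicator_def)
      ultimately show ?thesis
        by (simp add: Bochner_Integration.integral_diff prob_space)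
    qed
    \<comment> \<open>The Stein equation is evaluated at \<open>S \<omega>\<close>, and the factor
      \<open>S \<omega>\<close> is split into its summands.\<close>
    also have "\<dots> = expectation (\<lambda>\<omega>. lam * f (Suc (S \<omega>)) - (\<Sum>i=1..n. real (X i \<omega>) * f (S \<omega>)))"
      unfolding f_def stein_equation[OF lam_pos, symmetric]
      by (simp add: S_def sum_distrib_right)
    also have "\<dots> = lam * expectation (\<lambda>\<omega>. f (Suc (S \<omega>))) - (\<Sum>i=1..n. expectation (\<lambda>\<omega>. real (X i \<omega>) * f (S \<omega>)))"
      using f_int Xf_int by (subst Bochner_Integration.integral_diff) (auto intro!: Bochner_Integration.integral_sum)
    \<comment> \<open>Adding and subtracting the mean of \<open>S\<close> times
      \<open>expectation (\<lambda>\<omega>. f (Suc (S \<omega>)))\<close> leaves one discrepancy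
      \<open>d i\<close> per summand.\<close>
    also have "\<dots> = (lam - expectation (\<lambda>\<omega>. real (S \<omega>))) * expectation (\<lambda>\<omega>. f (Suc (S \<omega>))) + (\<Sum>i=1..n. d i)"
      unfolding ES d_def by (simp add: sum_subtractf sum_distrib_right algebra_simps)
    finally have decomp: "prob {\<omega> \<in> space M. S \<omega> \<in> A} - measure_pmf.prob (poisson_pmf lam) A = \<dots>" .
    have "\<bar>expectation (\<lambda>\<omega>. f (Suc (S \<omega>)))\<bar> \<le> expectation (\<lambda>\<omega>. \<bar>f (Suc (S \<omega>))\<bar>)"
      by (rule integral_abs_bound)
    also have "\<dots> \<le> expectation (\<lambda>\<omega>. B)"
      using f_int f_le by (intro integral_mono) auto
    finally have Ef: "\<bar>expectation (\<lambda>\<omega>. f (Suc (S \<omega>)))\<bar> \<le> B" by (simp add: prob_space)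
    have d: "ennreal \<bar>d i\<bar> \<le> ennreal (1 / max 1 lam) * \<epsilon> i" if i: "i \<in> {1..n}" for i
    proof -
      define W where "W \<omega> = (\<Sum>j\<in>{1..n} - {i}. X j \<omega>)" for \<omega>
      have SW: "S \<omega> = X i \<omega> + W \<omega>" for \<omega>
        unfolding S_def W_def using i by (intro sum.remove) auto
      have ind: "indep_var (count_space UNIV) (X i) (count_space UNIV) W"
        unfolding W_def using i by (intro indep_var_sum_nat[OF X_indep]) auto
      show ?thesis
        unfolding d_def \<epsilon>_def SW \<mu>_def
        by (rule size_bias_discrepancy[OF ind _ X_integrable[OF i] q_sums[OF i] _ f_le lip])
           (use X_law[OF i] size_bias_eq[OF i] mean[OF i] in \<open>auto simp: p_def \<mu>_def\<close>)
    qed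
    have "\<bar>prob {\<omega> \<in> space M. S \<omega> \<in> A} - measure_pmf.prob (poisson_pmf lam) A\<bar>
      \<le> \<bar>lam - expectation (\<lambda>\<omega>. real (S \<omega>))\<bar> * B + (\<Sum>i=1..n. \<bar>d i\<bar>)"
      unfolding decomp using Ef
      by (intro order.trans[OF abs_triangle_ineq] add_mono sum_abs) (auto simp: abs_mult intro!: mult_left_mono)
    then have "ennreal \<bar>prob {\<omega> \<in> space M. S \<omega> \<in> A} - measure_pmf.prob (poisson_pmf lam) A\<bar>
      \<le> ennreal (\<bar>lam - expectation (\<lambda>\<omega>. real (S \<omega>))\<bar> * B) + (\<Sum>i=1..n. ennreal \<bar>d i\<bar>)"
      by (subst sum_ennreal) (auto simp: B_def sum_nonneg simp flip: ennreal_plus intro!: ennreal_leI)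
    also have "\<dots> \<le> ennreal (\<bar>lam - expectation (\<lambda>\<omega>. real (S \<omega>))\<bar> * B) + (\<Sum>i=1..n. ennreal (1 / max 1 lam) * \<epsilon> i)"
      using d by (intro add_mono sum_mono) auto
    finally show ?thesis by (simp add: B_def sum_distrib_left)
  qed
  let ?R = "ennreal (\<bar>lam - expectation (\<lambda>\<omega>. real (S \<omega>))\<bar> / max 1 (sqrt lam))
        + ennreal (1 / max 1 lam) * (\<Sum>i=1..n. \<epsilon> i)"
  have "ennreal (tv_dist M S M' N) \<le> ?R"
  \<comment> \<open>Only a finite bound needs an argument, and there the supremum can be bounded in
    the reals.\<close>
  proof (cases ?R)
    case (real r)
    have "tv_dist M S M' N \<le> r"
      unfolding tv_dist_def
    proof (rule cSUP_least)
      fix A :: "int set"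
      \<comment> \<open>Negative integers are never attained, so a set of integers matters only
        through its preimage under \<open>int\<close>.\<close>
      have "M'.prob {\<omega> \<in> space M'. int (N \<omega>) \<in> A} = measure (distr M' (count_space UNIV) N) (int -` A)"
        using N_measurable by (subst measure_distr) (auto intro!: arg_cong[where f = M'.prob])
      then show "\<bar>prob {\<omega> \<in> space M. int (S \<omega>) \<in> A} - M'.prob {\<omega> \<in> space M'. int (N \<omega>) \<in> A}\<bar> \<le> r"
        using bound[of "int -` A"] real by (simp add: N_law)
    qed simp
    then show ?thesis using real by (simp add: ennreal_leI)
  qed simp
  then show ?thesis
    by (simp only: S_def[abs_def] \<epsilon>_def \<mu>_def p_def q_def Suc_eq_plus1)
qed

end
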